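(* Let $m\geqslant 1$ and $\alpha\in(0,1)$. Suppose the p-values $p=(p_1,\dots,p_m)$ satisfy the basic independence (BI) assumptions, with $m_0=\#I_0$ true null hypotheses. Consider the step down (SD) test with critical values $(\alpha_i)_{i=1,\dots,m}$ given either by $\alpha_i=b_i$ for all $i$, where $b_i=\frac{i\alpha}{m}$, or by the data dependent values $\alpha_i=a_i$ for all $i$, where $a_i=b_{m\hat F_m(p_{i:m})}$. In both cases $$\mathrm{FDR}\leqslant \alpha\,\frac{m_0}{m}.$$
   Context: Multiple testing setting: there are $m$ null hypotheses $H_1,\dots,H_m$ with p-values $p=(p_1,\dots,p_m)$, a random vector in $[0,1]^m$ with distribution $P$. Basic independence (BI) assumptions: (1) The index set is a disjoint union $\{1,\dots,m\}=I_0\cup I_1$ of the (fixed, non-random, unknown) set $I_0$ of true null hypotheses and the set $I_1$ of false null hypotheses. (2) The random vectors $(p_i)_{i\in I_0}$ and $(p_i)_{i\in I_1}$ are independent; any dependence structure is allowed within $(p_i)_{i\in I_1}$. (3) The p-values $(p_i)_{i\in I_0}$ are independent and stochastically larger than or equal to the uniform distribution on $[0,1]$, i.e. $P(p_i\leqslant x)\leqslant x$ for all $x\in[0,1]$ and $i\in I_0$. A multiple test is a rule that rejects a subset of the hypotheses depending on $p$. Let $R$ be the number of rejected hypotheses and $V$ the number of rejected hypotheses $H_i$ with $i\in I_0$. The false discovery rate is $$\mathrm{FDR}=\mathbb{E}\left[\frac{V}{\max(R,1)}\right].$$ Let $p_{1:m}\leqslant\dots\leqslant p_{m:m}$ be the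 order statistics of $p$, and let $\hat F_m(t)=\frac1m\#\{j: p_j\leqslant t\}$ be the empirical distribution function of $p_1,\dots,p_m$ (so $m\hat F_m(p_{i:m})$ is the number of p-values that are $\leqslant p_{i:m}$). Step down (SD) test with (possibly data dependent) critical values $\alpha_1,\dots,\alpha_m$: put $$R=\max\{j\in\{1,\dots,m\}:\ p_{i:m}\leqslant\alpha_i \text{ for all } i\leqslant j\},$$ with $R=0$ if this set is empty. The SD test rejects all null hypotheses which belong to the p-values $p_{i:m}$ with $i\leqslant R$. *)

theory Defs
  imports "HOL-Probability.Probability"
begin

text \<open>
  A realisation of the p-values is a function \<open>x :: nat \<Rightarrow> real\<close>, of which only the
  values on \<open>{1..m}\<close> matter.  All indices start at 1.
\<close>

locale basic_independence = prob_space M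
  for M :: "'w measure" +
  fixes m :: nat and I0 I1 :: "nat set" and p :: "nat \<Rightarrow> 'w \<Rightarrow> real"
  assumes p_measurable: "\<And>i. i \<in> {1..m} \<Longrightarrow> random_variable borel (p i)"
    and p_range: "\<And>i \<omega>. i \<in> {1..m} \<Longrightarrow> \<omega> \<in> space M \<Longrightarrow> p i \<omega> \<in> {0..1}"
    and index_union: "I0 \<union> I1 = {1..m}"
    and index_disjoint: "I0 \<inter> I1 = {}"
    and true_false_indep:
      "indep_var (\<Pi>\<^sub>M i\<in>I0. borel) (\<lambda>\<omega>. \<lambda>i\<in>I0. p i \<omega>)
                 (\<Pi>\<^sub>M i\<in>I1. borel) (\<lambda>\<omega>. \<lambda>i\<in>I1. p i \<omega>)"
    and true_indep: "indep_vars (\<lambda>_. borel) p I0"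
    and true_superuniform:
      "\<And>i x. i \<in> I0 \<Longrightarrow> x \<in> {0..1} \<Longrightarrow> prob {\<omega> \<in> space M. p i \<omega> \<le> x} \<le> x"

definition order_stat :: "nat \<Rightarrow> (nat \<Rightarrow> real) \<Rightarrow> nat \<Rightarrow> real" where
  "order_stat m x i = sort (map x [1..<Suc m]) ! (i - 1)"

definition ecdf :: "nat \<Rightarrow> (nat \<Rightarrow> real) \<Rightarrow> real \<Rightarrow> real" where
  "ecdf m x t = real (card {j \<in> {1..m}. x j \<le> t}) / real m"

text \<open>
  The index of the linear critical values is a real number so that the integral-valued real
  number \<open>m * ecdf m x t\<close> can be used as an index without rounding.
\<close>

definition crit_b :: "nat \<Rightarrow> real \<Rightarrow> real \<Rightarrow> real" where
  "crit_b m \<alpha> r = r * \<alpha> / real m"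

definition crit_a :: "nat \<Rightarrow> real \<Rightarrow> (nat \<Rightarrow> real) \<Rightarrow> nat \<Rightarrow> real" where
  "crit_a m \<alpha> x i = crit_b m \<alpha> (real m * ecdf m x (order_stat m x i))"

text \<open>
  The critical values \<open>c\<close> of a step down test may depend on the realisation \<open>x\<close>.
\<close>

definition sd_number :: "nat \<Rightarrow> ((nat \<Rightarrow> real) \<Rightarrow> nat \<Rightarrow> real) \<Rightarrow> (nat \<Rightarrow> real) \<Rightarrow> nat" where
  "sd_number m c x =
     (let J = {j \<in> {1..m}. \<forall>i\<in>{1..j}. order_stat m x i \<le> c x i}
      in if J = {} then 0 else Max J)"

text \<open>
  A hypothesis is rejected if its p-value is one of the \<open>sd_number m c x\<close> smallest order
  statistics.  For \<open>crit_a\<close> and for \<open>crit_b\<close> with \<open>\<alpha> > 0\<close>, a p-value tied with a rejected one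
  also passes the step down comparison, so exactly \<open>sd_number m c x\<close> hypotheses are rejected.
\<close>

definition sd_test :: "nat \<Rightarrow> ((nat \<Rightarrow> real) \<Rightarrow> nat \<Rightarrow> real) \<Rightarrow> (nat \<Rightarrow> real) \<Rightarrow> nat set" where
  "sd_test m c x = {h \<in> {1..m}. \<exists>i\<in>{1..sd_number m c x}. x h = order_stat m x i}"

text \<open>
  A multiple test \<open>\<phi>\<close> maps a realisation of the p-values to the set of rejected hypotheses.
\<close>

definition fdr ::
  "'w measure \<Rightarrow> nat set \<Rightarrow> (nat \<Rightarrow> 'w \<Rightarrow> real) \<Rightarrow> ((nat \<Rightarrow> real) \<Rightarrow> nat set) \<Rightarrow> real" where
  "fdr M I0 p \<phi> =
     (\<integral>\<omega>. (let rejected = \<phi> (\<lambda>i. p i \<omega>)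
           in real (card (rejected \<inter> I0)) / real (max (card rejected) 1)) \<partial>M)"

end

theory Submission
  imports Defs
begin

text \<open>
  Both tests reject \<open>h\<close> iff every p-value \<open>v \<le> x h\<close> satisfies \<open>v \<le> \<alpha> / m * n v\<close>, where \<open>n v\<close> is
  the smallest rank of \<open>v\<close> for the critical values \<open>b\<close> and its largest rank for the critical
  values \<open>a\<close>; with ties these differ.  For both choices of \<open>n\<close> the rejection set \<open>D x\<close>
  has the following two properties.

  Self-consistency: a rejected p-value is at most \<open>\<alpha> / m * |D x|\<close>.

  Rigidity (\<open>rejections_rigid\<close>): if \<open>x\<close> and \<open>y\<close> differ only in the \<open>i\<close>-th p-value and \<open>i\<close> is rejected
  under both, then \<open>D x = D y\<close>.  This takes the place of monotonicity of the number of rejections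
  in each p-value, which fails for the critical values \<open>a\<close>: for \<open>m = 2\<close> the p-values \<open>(\<alpha>, \<alpha>)\<close> are
  both rejected, whereas \<open>(0.6 \<alpha>, \<alpha>)\<close> leads to no rejection.

  Since \<open>i\<close> is always rejected once its p-value is replaced by 0, rigidity says that on the event
  \<open>i \<in> D p\<close> the number of rejections is \<open>R\<^sub>i = |D (p(i := 0))|\<close>, which does not involve \<open>p i\<close>.  Hence
  \<open>1(i \<in> D p) / |D p| \<le> 1(p i \<le> \<alpha> / m * R\<^sub>i) / R\<^sub>i\<close>.  For \<open>i \<in> I0\<close> the variable \<open>p i\<close> is independent
  of all other p-values together, and hence of \<open>R\<^sub>i\<close>, so that splitting by the value of \<open>R\<^sub>i\<close> and using that
  \<open>p i\<close> is stochastically larger than uniform bounds the expectation of the right-hand side by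
  \<open>\<alpha> / m\<close>.  The sum over \<open>i \<in> I0\<close> is the claim.
\<close>

section \<open>Step down rejection sets without order statistics\<close>

text \<open>
  The parameter \<open>r\<close> is \<open>(<)\<close> or \<open>(\<le>)\<close>.  The index \<open>j\<close> is inserted so that the cardinality is
  the smallest rank of the value \<open>x j\<close> in the first case and its largest rank in the second.
\<close>

definition rank_of :: "nat \<Rightarrow> (real \<Rightarrow> real \<Rightarrow> bool) \<Rightarrow> (nat \<Rightarrow> real) \<Rightarrow> nat \<Rightarrow> nat" where
  "rank_of m r x j = card (insert j {k \<in> {1..m}. r (x k) (x j)})"

definition rejections :: "nat \<Rightarrow> real \<Rightarrow> (real \<Rightarrow> real \<Rightarrow> bool) \<Rightarrow> (nat \<Rightarrow> real) \<Rightarrow> nat set" where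
  "rejections m \<beta> r x =
     {h \<in> {1..m}. \<forall>j\<in>{1..m}. x j \<le> x h \<longrightarrow> x j \<le> \<beta> * real (rank_of m r x j)}"

lemma finite_rejections [simp]: "finite (rejections m \<beta> r x)"
  by (simp add: rejections_def)

lemma rejections_le:
  assumes r: "r = (<) \<or> r = (\<le>)" and "0 \<le> \<beta>" and h: "h \<in> rejections m \<beta> r x"
  shows "x h \<le> \<beta> * real (card (rejections m \<beta> r x))"
proof -
  have "insert h {k \<in> {1..m}. r (x k) (x h)} \<subseteq> rejections m \<beta> r x"
    using h r by (auto simp: rejections_def)
  then have "rank_of m r x h \<le> card (rejections m \<beta> r x)"
    unfolding rank_of_def by (intro card_mono) auto
  then have "\<beta> * real (rank_of m r x h) \<le> \<beta> * real (card (rejections m \<beta> r x))"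
    using \<open>0 \<le> \<beta>\<close> by (intro mult_left_mono) auto
  moreover have "x h \<le> \<beta> * real (rank_of m r x h)"
    using h by (auto simp: rejections_def)
  ultimately show ?thesis by linarith
qed

text \<open>
  A value \<open>x j\<close> that is at most \<open>y i\<close> passes under \<open>y\<close> because \<open>i\<close> is rejected there.  A larger one
  has \<open>i\<close> below it under \<open>y\<close>, so its rank under \<open>y\<close> is no smaller than under \<open>x\<close>.
\<close>

lemma rejections_subset_of_agree:
  assumes r: "r = (<) \<or> r = (\<le>)" and "0 \<le> \<beta>"
    and agree: "\<And>k. k \<in> {1..m} \<Longrightarrow> k \<noteq> i \<Longrightarrow> x k = y k"
    and iy: "i \<in> rejections m \<beta> r y"
  shows "rejections m \<beta> r x \<subseteq> rejections m \<beta> r y"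
proof
  fix h assume h: "h \<in> rejections m \<beta> r x"
  show "h \<in> rejections m \<beta> r y"
  proof (cases "h = i")
    case True
    then show ?thesis using iy by simp
  next
    case False
    have hm: "h \<in> {1..m}" using h by (simp add: rejections_def)
    have "y j \<le> \<beta> * real (rank_of m r y j)" if j: "j \<in> {1..m}" "y j \<le> y h" for j
    proof (cases "y j \<le> y i")
      case True
      then show ?thesis using iy j by (auto simp: rejections_def)
    next
      case False
      then have "j \<noteq> i" by auto
      have eq: "x j = y j" "x h = y h"
        using agree j hm \<open>j \<noteq> i\<close> \<open>h \<noteq> i\<close> by auto
      have "{k \<in> {1..m}. r (x k) (x j)} \<subseteq> {k \<in> {1..m}. r (y k) (y j)}"
      proof safe
        fix k assume k: "k \<in> {1..m}" "r (x k) (x j)"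
        show "r (y k) (y j)"
          using k agree[of k] eq False r by (cases "k = i") auto
      qed
      then have "rank_of m r x j \<le> rank_of m r y j"
        unfolding rank_of_def by (intro card_mono) auto
      then have "\<beta> * real (rank_of m r x j) \<le> \<beta> * real (rank_of m r y j)"
        using \<open>0 \<le> \<beta>\<close> by (intro mult_left_mono) auto
      moreover have "x j \<le> \<beta> * real (rank_of m r x j)"
      proof -
        have "\<forall>j\<in>{1..m}. x j \<le> x h \<longrightarrow> x j \<le> \<beta> * real (rank_of m r x j)"
          using h by (simp add: rejections_def)
        moreover have "x j \<le> x h" using j eq by simp
        ultimately show ?thesis using j(1) by blast
      qed
      ultimately show ?thesis using eq by linarith
    qed
    then show ?thesis using hm by (auto simp: rejections_def)
  qed
qed

lemma rejections_rigid:
  assumes "r = (<) \<or> r = (\<le>)" and "0 \<le> \<beta>"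
    and "\<And>k. k \<in> {1..m} \<Longrightarrow> k \<noteq> i \<Longrightarrow> x k = y k"
    and "i \<in> rejections m \<beta> r x" and "i \<in> rejections m \<beta> r y"
  shows "rejections m \<beta> r x = rejections m \<beta> r y"
  using rejections_subset_of_agree[of r \<beta> m i x y] rejections_subset_of_agree[of r \<beta> m i y x] assms
  by (intro equalityI) auto

lemma zero_mem_rejections:
  assumes "0 \<le> \<beta>" and "i \<in> {1..m}"
  shows "i \<in> rejections m \<beta> r (x(i := 0))"
proof -
  have "y \<le> \<beta> * real n" if "y \<le> 0" for y :: real and n :: nat
    using that \<open>0 \<le> \<beta>\<close> by (meson mult_nonneg_nonneg of_nat_0_le_iff order_trans)
  then show ?thesis using assms(2) unfolding rejections_def by simp
qed

section \<open>The tests in terms of rejection sets\<close>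

lemma sorted_nth_less_iff:
  fixes v :: "'a::linorder"
  assumes "sorted xs" and "n < length xs"
  shows "xs ! n < v \<longleftrightarrow> n < length (filter (\<lambda>y. y < v) xs)"
  using assms
proof (induction xs arbitrary: n)
  case (Cons a xs)
  show ?case
  proof (cases n)
    case 0
    have "filter (\<lambda>y. y < v) xs = []" if "\<not> a < v"
      using that Cons.prems by (auto simp: filter_empty_conv)
    then show ?thesis using 0 by auto
  next
    case (Suc k)
    have "filter (\<lambda>y. y < v) xs = []" if "\<not> a < v"
      using that Cons.prems by (auto simp: filter_empty_conv)
    then show ?thesis using Suc Cons by auto
  qed
qed simp

lemma order_stat_less_iff:
  assumes "i \<in> {1..m}"
  shows "order_stat m x i < v \<longleftrightarrow> i \<le> card {k \<in> {1..m}. x k < v}"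
proof -
  let ?s = "sort (map x [1..<Suc m])"
  have "length (filter (\<lambda>y. y < v) ?s) = length (filter (\<lambda>k. x k < v) [1..<Suc m])"
    by (simp add: filter_sort filter_map o_def del: upt_Suc)
  also have "\<dots> = card (set (filter (\<lambda>k. x k < v) [1..<Suc m]))"
    by (intro distinct_card[symmetric]) auto
  also have "set (filter (\<lambda>k. x k < v) [1..<Suc m]) = {k \<in> {1..m}. x k < v}"
    by auto
  finally have len: "length (filter (\<lambda>y. y < v) ?s) = card {k \<in> {1..m}. x k < v}" .
  have "i - 1 < length ?s" using assms by auto
  then have "order_stat m x i < v \<longleftrightarrow> i - 1 < card {k \<in> {1..m}. x k < v}"
    unfolding order_stat_def using sorted_nth_less_iff[of ?s "i - 1" v] len by simp
  then show ?thesis using assms by auto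
qed

lemma order_stat_image: "order_stat m x ` {1..m} = x ` {1..m}"
proof -
  let ?s = "sort (map x [1..<Suc m])"
  have "order_stat m x ` {1..m} = (!) ?s ` ((\<lambda>i. i - 1) ` {1..m})"
    by (auto simp: order_stat_def image_iff simp del: upt_Suc)
  also have "(\<lambda>i. i - 1) ` {1..m} = {0..<length ?s}"
    by (force simp: image_iff intro!: bexI[where x = "Suc _"])
  also have "(!) ?s ` {0..<length ?s} = set ?s"
    by (auto simp: set_conv_nth simp del: upt_Suc)
  also have "\<dots> = x ` {1..m}" by auto
  finally show ?thesis .
qed

lemma order_stat_mono:
  assumes "i \<le> j" "i \<in> {1..m}" "j \<in> {1..m}"
  shows "order_stat m x i \<le> order_stat m x j"
  using assms unfolding order_stat_def by (intro sorted_nth_mono) auto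

lemma sd_test_eq:
  "sd_test m c x =
     {h \<in> {1..m}. \<exists>i\<in>{1..m}. x h = order_stat m x i \<and> (\<forall>l\<in>{1..i}. order_stat m x l \<le> c x l)}"
proof -
  define J where "J = {j \<in> {1..m}. \<forall>l\<in>{1..j}. order_stat m x l \<le> c x l}"
  have n: "sd_number m c x = (if J = {} then 0 else Max J)"
    unfolding sd_number_def J_def Let_def by (rule refl)
  have "finite J" by (simp add: J_def)
  have "i \<in> {1..sd_number m c x} \<longleftrightarrow> i \<in> J" for i
  proof
    assume i: "i \<in> {1..sd_number m c x}"
    then have "J \<noteq> {}" "i \<le> Max J" using n by (auto split: if_splits)
    moreover obtain k where "k \<in> J" "i \<le> k"
      using \<open>i \<le> Max J\<close> Max_in[OF \<open>finite J\<close> \<open>J \<noteq> {}\<close>] by blast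
    ultimately show "i \<in> J" using i by (auto simp: J_def)
  next
    assume "i \<in> J"
    then have "i \<le> Max J" "J \<noteq> {}" using \<open>finite J\<close> by auto
    moreover have "1 \<le> i" using \<open>i \<in> J\<close> by (simp add: J_def)
    ultimately show "i \<in> {1..sd_number m c x}" using n by simp
  qed
  then have "sd_test m c x = {h \<in> {1..m}. \<exists>i\<in>J. x h = order_stat m x i}"
    unfolding sd_test_def by blast
  then show ?thesis unfolding J_def by blast
qed

lemma sd_test_crit_a:
  assumes "m \<ge> 1"
  shows "sd_test m (crit_a m \<alpha>) x = rejections m (\<alpha> / real m) (\<le>) x"
proof -
  have crit: "crit_a m \<alpha> x i = \<alpha> / real m * real (card {k \<in> {1..m}. x k \<le> order_stat m x i})" for i
    using assms by (simp add: crit_a_def crit_b_def ecdf_def)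
  have rank: "rank_of m (\<le>) x j = card {k \<in> {1..m}. x k \<le> x j}" if "j \<in> {1..m}" for j
    using that by (auto simp: rank_of_def intro!: arg_cong[where f = card])
  show ?thesis
  proof (intro set_eqI iffI)
    fix h assume "h \<in> sd_test m (crit_a m \<alpha>) x"
    then obtain i where h: "h \<in> {1..m}" "i \<in> {1..m}" "x h = order_stat m x i"
      and ok: "\<And>l. l \<in> {1..i} \<Longrightarrow> order_stat m x l \<le> crit_a m \<alpha> x l"
      by (auto simp: sd_test_eq)
    have "x j \<le> \<alpha> / real m * real (rank_of m (\<le>) x j)" if j: "j \<in> {1..m}" "x j \<le> x h" for j
    proof -
      obtain l where l: "l \<in> {1..m}" "x j = order_stat m x l"
        using j order_stat_image[of m x] by blast
      have "\<exists>l\<in>{1..i}. x j = order_stat m x l"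
      proof (cases "l \<le> i")
        case True
        then show ?thesis using l by auto
      next
        case False
        then have "order_stat m x i \<le> order_stat m x l"
          using order_stat_mono h l by simp
        then have "x j = order_stat m x i" using j h l by simp
        then show ?thesis using h by auto
      qed
      then show ?thesis using ok crit rank j by metis
    qed
    then show "h \<in> rejections m (\<alpha> / real m) (\<le>) x" using h by (simp add: rejections_def)
  next
    fix h assume h: "h \<in> rejections m (\<alpha> / real m) (\<le>) x"
    then have hm: "h \<in> {1..m}" by (simp add: rejections_def)
    then obtain i where i: "i \<in> {1..m}" "x h = order_stat m x i"
      using order_stat_image[of m x] by blast
    have "order_stat m x l \<le> crit_a m \<alpha> x l" if l: "l \<in> {1..i}" for l
    proof -
      have lm: "l \<in> {1..m}" using l i by auto
      then obtain j where j: "j \<in> {1..m}" "order_stat m x l = x j"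
        using order_stat_image[of m x] by blast
      have "x j \<le> x h" using order_stat_mono[of l i m x] l lm i j by auto
      then show ?thesis using h j rank crit by (auto simp: rejections_def)
    qed
    then show "h \<in> sd_test m (crit_a m \<alpha>) x" using hm i by (auto simp: sd_test_eq)
  qed
qed

text \<open>
  For tied order statistics the condition \<open>order_stat m x l \<le> crit_b m \<alpha> l\<close> is strongest at the
  smallest rank of the tie, so that only smallest ranks matter.
\<close>

lemma sd_test_crit_b:
  assumes "m \<ge> 1" and "0 \<le> \<alpha>"
  shows "sd_test m (\<lambda>x i. crit_b m \<alpha> (real i)) x = rejections m (\<alpha> / real m) (<) x"
proof -
  have rank: "rank_of m (<) x j = Suc (card {k \<in> {1..m}. x k < x j})" for j
    by (simp add: rank_of_def)
  have crit: "crit_b m \<alpha> (real i) = \<alpha> / real m * real i" for i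
    by (simp add: crit_b_def)
  show ?thesis
  proof (intro set_eqI iffI)
    fix h assume "h \<in> sd_test m (\<lambda>x i. crit_b m \<alpha> (real i)) x"
    then obtain i where h: "h \<in> {1..m}" "i \<in> {1..m}" "x h = order_stat m x i"
      and ok: "\<And>l. l \<in> {1..i} \<Longrightarrow> order_stat m x l \<le> crit_b m \<alpha> (real l)"
      by (auto simp: sd_test_eq)
    have "x j \<le> \<alpha> / real m * real (rank_of m (<) x j)" if j: "j \<in> {1..m}" "x j \<le> x h" for j
    proof -
      have "\<not> order_stat m x i < x j" using j h by simp
      then have le: "rank_of m (<) x j \<le> i"
        using order_stat_less_iff[of i m x "x j"] h rank by simp
      then have mem: "rank_of m (<) x j \<in> {1..m}" using rank h by auto
      have "\<not> order_stat m x (rank_of m (<) x j) < x j"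
        using order_stat_less_iff[OF mem, of x "x j"] rank by simp
      then show ?thesis using ok[of "rank_of m (<) x j"] le mem crit by auto
    qed
    then show "h \<in> rejections m (\<alpha> / real m) (<) x" using h(1) by (simp add: rejections_def)
  next
    fix h assume h: "h \<in> rejections m (\<alpha> / real m) (<) x"
    then have hm: "h \<in> {1..m}" by (simp add: rejections_def)
    then obtain i where i: "i \<in> {1..m}" "x h = order_stat m x i"
      using order_stat_image[of m x] by blast
    have "order_stat m x l \<le> crit_b m \<alpha> (real l)" if l: "l \<in> {1..i}" for l
    proof -
      have lm: "l \<in> {1..m}" using l i by auto
      then obtain j where j: "j \<in> {1..m}" "order_stat m x l = x j"
        using order_stat_image[of m x] by blast
      have "x j \<le> x h" using order_stat_mono[of l i m x] l lm i j by auto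
      then have "x j \<le> \<alpha> / real m * real (rank_of m (<) x j)"
        using h j by (auto simp: rejections_def)
      moreover have "rank_of m (<) x j \<le> l"
        using order_stat_less_iff[OF lm, of x "x j"] j rank by simp
      then have "\<alpha> / real m * real (rank_of m (<) x j) \<le> \<alpha> / real m * real l"
        using assms by (intro mult_left_mono) auto
      ultimately show ?thesis using j crit by simp
    qed
    then show "h \<in> sd_test m (\<lambda>x i. crit_b m \<alpha> (real i)) x" using hm i by (auto simp: sd_test_eq)
  qed
qed

section \<open>Independence of a true p-value from all the others\<close>

text \<open>
  Mutual independence of three variables makes the first independent of the pair of the other two,
  because the events \<open>{Y \<in> B, Z \<in> C}\<close> form a generator of \<open>\<sigma>(Y, Z)\<close> that is closed under
  intersection.  The conclusion speaks of \<open>\<sigma>\<close>-algebras since \<^const>\<open>prob_space.indep_var\<close> relates only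
  variables with values in the same type.
\<close>

lemma (in prob_space) indep_set_Pair:
  assumes [measurable]: "random_variable S X" "random_variable T Y" "random_variable U Z"
    and indep: "\<And>A B C. A \<in> sets S \<Longrightarrow> B \<in> sets T \<Longrightarrow> C \<in> sets U \<Longrightarrow>
      prob {\<omega> \<in> space M. X \<omega> \<in> A \<and> Y \<omega> \<in> B \<and> Z \<omega> \<in> C} =
        prob {\<omega> \<in> space M. X \<omega> \<in> A} * prob {\<omega> \<in> space M. Y \<omega> \<in> B} * prob {\<omega> \<in> space M. Z \<omega> \<in> C}"
  shows "indep_set (sigma_sets (space M) {X -` A \<inter> space M | A. A \<in> sets S})
    (sigma_sets (space M) {(\<lambda>\<omega>. (Y \<omega>, Z \<omega>)) -` P \<inter> space M | P. P \<in> sets (T \<Otimes>\<^sub>M U)})"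
proof -
  let ?G = "{X -` A \<inter> space M | A. A \<in> sets S}"
  let ?R = "{B \<times> C | B C. B \<in> sets T \<and> C \<in> sets U}"
  let ?H = "{(\<lambda>\<omega>. (Y \<omega>, Z \<omega>)) -` P \<inter> space M | P. P \<in> ?R}"
  have "indep_set (sigma_sets (space M) ?G) (sigma_sets (space M) ?H)"
  proof (intro indep_set_sigma_sets indep_setI)
    show "?G \<subseteq> events" by auto
    show "?H \<subseteq> events"
    proof clarify
      fix B C assume [measurable]: "B \<in> sets T" "C \<in> sets U"
      show "(\<lambda>\<omega>. (Y \<omega>, Z \<omega>)) -` (B \<times> C) \<inter> space M \<in> events" by measurable
    qed
    show "Int_stable ?G"
    proof (rule Int_stableI, clarsimp)
      fix A B assume "A \<in> sets S" "B \<in> sets S"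
      then show "\<exists>C. X -` A \<inter> space M \<inter> (X -` B \<inter> space M) = X -` C \<inter> space M \<and> C \<in> sets S"
        by (intro exI[of _ "A \<inter> B"]) auto
    qed
    show "Int_stable ?H"
    proof (rule Int_stableI)
      fix P Q assume "P \<in> ?H" "Q \<in> ?H"
      then obtain B C B' C' where
        P: "P = (\<lambda>\<omega>. (Y \<omega>, Z \<omega>)) -` (B \<times> C) \<inter> space M" "B \<in> sets T" "C \<in> sets U" and
        Q: "Q = (\<lambda>\<omega>. (Y \<omega>, Z \<omega>)) -` (B' \<times> C') \<inter> space M" "B' \<in> sets T" "C' \<in> sets U"
        by blast
      have "P \<inter> Q = (\<lambda>\<omega>. (Y \<omega>, Z \<omega>)) -` ((B \<inter> B') \<times> (C \<inter> C')) \<inter> space M"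
        using P Q by auto
      moreover have "(B \<inter> B') \<times> (C \<inter> C') \<in> ?R" using P Q by blast
      ultimately show "P \<inter> Q \<in> ?H" by blast
    qed
    fix a b assume "a \<in> ?G" "b \<in> ?H"
    then obtain A B C where a: "a = X -` A \<inter> space M" and A: "A \<in> sets S"
      and b: "b = (\<lambda>\<omega>. (Y \<omega>, Z \<omega>)) -` (B \<times> C) \<inter> space M" and B: "B \<in> sets T" and C: "C \<in> sets U"
      by blast
    have "X \<omega> \<in> space S" if "\<omega> \<in> space M" for \<omega>
      using that measurable_space[of X M S] by simp
    then have "{\<omega> \<in> space M. X \<omega> \<in> space S \<and> Y \<omega> \<in> B \<and> Z \<omega> \<in> C} = b"
      and "{\<omega> \<in> space M. X \<omega> \<in> space S} = space M"
      unfolding b by auto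
    then have "prob b = prob {\<omega> \<in> space M. Y \<omega> \<in> B} * prob {\<omega> \<in> space M. Z \<omega> \<in> C}"
      using indep[of "space S" B C] B C by (simp add: prob_space)
    moreover have "a \<inter> b = {\<omega> \<in> space M. X \<omega> \<in> A \<and> Y \<omega> \<in> B \<and> Z \<omega> \<in> C}"
      and "a = {\<omega> \<in> space M. X \<omega> \<in> A}"
      unfolding a b by auto
    ultimately show "prob (a \<inter> b) = prob a * prob b"
      using indep[OF A B C] by simp
  qed
  moreover have "sigma_sets (space M) ?H =
      sigma_sets (space M) {(\<lambda>\<omega>. (Y \<omega>, Z \<omega>)) -` P \<inter> space M | P. P \<in> sets (T \<Otimes>\<^sub>M U)}"
  proof -
    have "(\<lambda>\<omega>. (Y \<omega>, Z \<omega>)) \<in> space M \<rightarrow> space T \<times> space U"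
      using measurable_space[of Y M T] measurable_space[of Z M U] by auto
    from sigma_sets_vimage_commute[OF this, of ?R]
    have "{(\<lambda>\<omega>. (Y \<omega>, Z \<omega>)) -` P \<inter> space M | P. P \<in> sets (T \<Otimes>\<^sub>M U)} = sigma_sets (space M) ?H"
      unfolding sets_pair_measure .
    moreover have "sigma_sets (space M) (sigma_sets (space M) ?H) = sigma_sets (space M) ?H"
      by (rule sigma_sets_sigma_sets_eq) auto
    ultimately show ?thesis by simp
  qed
  ultimately show ?thesis by simp
qed

text \<open>
  The hypotheses give independence within the true p-values and of the true from the false ones.
  Applied to \<open>p i\<close>, the other true p-values and the false p-values, they yield mutual independence.
  The function \<open>g\<close> will be the number of rejections after \<open>p i\<close> has been replaced by 0.
\<close>

lemma (in basic_independence) true_indep_rest: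
  fixes g :: "(nat \<Rightarrow> real) \<Rightarrow> real"
  assumes i: "i \<in> I0" and g: "g \<in> borel_measurable (\<Pi>\<^sub>M j\<in>{1..m} - {i}. borel)"
  shows "indep_var borel (p i) borel (\<lambda>\<omega>. g (\<lambda>j\<in>{1..m} - {i}. p j \<omega>))"
proof -
  let ?K = "I0 - {i}"
  let ?T = "PiM ?K (\<lambda>_. borel :: real measure)" and ?U = "PiM I1 (\<lambda>_. borel :: real measure)"
  let ?Y = "\<lambda>\<omega>. \<lambda>j\<in>?K. p j \<omega>" and ?Z = "\<lambda>\<omega>. \<lambda>j\<in>I1. p j \<omega>"
  let ?W = "\<lambda>\<omega>. g (\<lambda>j\<in>{1..m} - {i}. p j \<omega>)"
  have I: "I0 \<subseteq> {1..m}" "I1 \<subseteq> {1..m}" "?K \<union> I1 = {1..m} - {i}" "?K \<inter> I1 = {}"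
    using i index_union index_disjoint by auto
  have "i \<in> {1..m}" using i I(1) by (rule rev_subsetD)
  then have "random_variable borel (p i)" by (rule p_measurable)
  moreover have "random_variable ?T ?Y"
    using I(1) by (intro measurable_restrict p_measurable) blast
  moreover have "random_variable ?U ?Z"
    using I(2) by (intro measurable_restrict p_measurable) blast
  ultimately have rv: "random_variable borel (p i)" "random_variable ?T ?Y" "random_variable ?U ?Z"
    by auto
  have XY: "indep_var (PiM {i} (\<lambda>_. borel)) (\<lambda>\<omega>. \<lambda>j\<in>{i}. p j \<omega>) ?T ?Y"
    using i by (intro indep_var_restrict[OF true_indep]) auto
  have indep: "indep_set (sigma_sets (space M) {p i -` A \<inter> space M | A. A \<in> sets borel})
    (sigma_sets (space M) {(\<lambda>\<omega>. (?Y \<omega>, ?Z \<omega>)) -` P \<inter> space M | P. P \<in> sets (?T \<Otimes>\<^sub>M ?U)})"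
  proof (rule indep_set_Pair[OF rv])
    fix A B C assume A: "A \<in> sets (borel :: real measure)" and B: "B \<in> sets ?T" and C: "C \<in> sets ?U"
    let ?A = "{q \<in> space (PiM {i} (\<lambda>_. borel :: real measure)). q i \<in> A}"
    define D where "D = {q \<in> space (PiM I0 (\<lambda>_. borel :: real measure)). q i \<in> A \<and> restrict q ?K \<in> B}"
    have A': "?A \<in> sets (PiM {i} (\<lambda>_. borel))" using A by measurable
    have D: "D \<in> sets (PiM I0 (\<lambda>_. borel))"
    proof -
      have [measurable]: "(\<lambda>q. q i) \<in> borel_measurable (PiM I0 (\<lambda>_. borel :: real measure))"
        using i by (intro measurable_component_singleton) auto
      have [measurable]: "(\<lambda>q. restrict q ?K) \<in> PiM I0 (\<lambda>_. borel :: real measure) \<rightarrow>\<^sub>M ?T"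
        by (intro measurable_restrict_subset) auto
      show ?thesis unfolding D_def using A B by measurable
    qed
    have "prob {\<omega> \<in> space M. p i \<omega> \<in> A \<and> ?Y \<omega> \<in> B} =
        prob {\<omega> \<in> space M. p i \<omega> \<in> A} * prob {\<omega> \<in> space M. ?Y \<omega> \<in> B}"
      using indep_varD[OF XY A' B]
      by (simp add: vimage_def Int_def space_PiM conj_commute)
    moreover have "prob {\<omega> \<in> space M. p i \<omega> \<in> A \<and> ?Y \<omega> \<in> B \<and> ?Z \<omega> \<in> C} =
        prob {\<omega> \<in> space M. p i \<omega> \<in> A \<and> ?Y \<omega> \<in> B} * prob {\<omega> \<in> space M. ?Z \<omega> \<in> C}"
    proof -
      have mem: "(\<lambda>j\<in>I0. p j \<omega>) \<in> D \<longleftrightarrow> p i \<omega> \<in> A \<and> ?Y \<omega> \<in> B" for \<omega>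
        using i by (simp add: D_def space_PiM Int_absorb1)
      have "(\<lambda>\<omega>. (\<lambda>j\<in>I0. p j \<omega>, ?Z \<omega>)) -` (D \<times> C) \<inter> space M =
          {\<omega> \<in> space M. p i \<omega> \<in> A \<and> ?Y \<omega> \<in> B \<and> ?Z \<omega> \<in> C}"
        and "(\<lambda>\<omega>. \<lambda>j\<in>I0. p j \<omega>) -` D \<inter> space M = {\<omega> \<in> space M. p i \<omega> \<in> A \<and> ?Y \<omega> \<in> B}"
        and "?Z -` C \<inter> space M = {\<omega> \<in> space M. ?Z \<omega> \<in> C}"
        by (auto simp only: mem vimage_eq Int_iff mem_Sigma_iff mem_Collect_eq set_eq_iff)
      then show ?thesis using indep_varD[OF true_false_indep D C] by simp
    qed
    ultimately show "prob {\<omega> \<in> space M. p i \<omega> \<in> A \<and> ?Y \<omega> \<in> B \<and> ?Z \<omega> \<in> C} =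
        prob {\<omega> \<in> space M. p i \<omega> \<in> A} * prob {\<omega> \<in> space M. ?Y \<omega> \<in> B} * prob {\<omega> \<in> space M. ?Z \<omega> \<in> C}"
      by simp
  qed
  have gm: "(\<lambda>q. g (merge ?K I1 q)) \<in> borel_measurable (?T \<Otimes>\<^sub>M ?U)"
    using measurable_compose[OF measurable_merge[of ?K I1 "\<lambda>_. borel"], of g borel] g I by simp
  have W: "?W = (\<lambda>\<omega>. g (merge ?K I1 (?Y \<omega>, ?Z \<omega>)))"
  proof
    fix \<omega>
    have "(\<lambda>j\<in>{1..m} - {i}. p j \<omega>) = merge ?K I1 (?Y \<omega>, ?Z \<omega>)"
      unfolding I(3)[symmetric] by (auto simp: merge_def fun_eq_iff)
    then show "?W \<omega> = g (merge ?K I1 (?Y \<omega>, ?Z \<omega>))" by simp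
  qed
  have "{?W -` B \<inter> space M | B. B \<in> sets borel} \<subseteq>
      {(\<lambda>\<omega>. (?Y \<omega>, ?Z \<omega>)) -` P \<inter> space M | P. P \<in> sets (?T \<Otimes>\<^sub>M ?U)}"
  proof clarify
    fix B :: "real set" assume B: "B \<in> sets borel"
    let ?P = "(\<lambda>q. g (merge ?K I1 q)) -` B \<inter> space (?T \<Otimes>\<^sub>M ?U)"
    have "(?Y \<omega>, ?Z \<omega>) \<in> space (?T \<Otimes>\<^sub>M ?U)" for \<omega>
      by (simp add: space_pair_measure space_PiM)
    then have "?W -` B \<inter> space M = (\<lambda>\<omega>. (?Y \<omega>, ?Z \<omega>)) -` ?P \<inter> space M"
      unfolding W by blast
    moreover have "?P \<in> sets (?T \<Otimes>\<^sub>M ?U)" by (rule measurable_sets[OF gm B])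
    ultimately show "\<exists>P. ?W -` B \<inter> space M = (\<lambda>\<omega>. (?Y \<omega>, ?Z \<omega>)) -` P \<inter> space M \<and>
        P \<in> sets (?T \<Otimes>\<^sub>M ?U)" by blast
  qed
  from sigma_sets_mono'[OF this] have
    "indep_set (sigma_sets (space M) {p i -` A \<inter> space M | A. A \<in> sets borel})
      (sigma_sets (space M) {?W -` B \<inter> space M | B. B \<in> sets borel})"
    using indep unfolding indep_sets2_eq by blast
  moreover have "random_variable borel ?W"
    unfolding W using measurable_compose[OF measurable_Pair[OF rv(2,3)] gm] by simp
  ultimately show ?thesis using rv(1) by (simp add: indep_var_eq)
qed

section \<open>The leave-one-out bound\<close>

text \<open>
  On \<open>{R = k}\<close> the variable is \<open>1(X \<le> \<beta> * k) / k\<close>.  Independence gives this event the factor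
  \<open>prob {R = k}\<close>, and the linear threshold cancels the denominator \<open>k\<close>, so that each value of
  \<open>R\<close> contributes at most \<open>\<beta> * prob {R = k}\<close>.
\<close>

lemma (in prob_space) expectation_random_threshold_le:
  fixes X :: "'a \<Rightarrow> real" and R :: "'a \<Rightarrow> nat"
  assumes indep: "indep_var borel X borel (\<lambda>\<omega>. real (R \<omega>))"
    and R: "\<And>\<omega>. \<omega> \<in> space M \<Longrightarrow> R \<omega> \<in> {1..m}"
    and superuniform: "\<And>k. k \<in> {1..m} \<Longrightarrow> prob {\<omega> \<in> space M. X \<omega> \<le> \<beta> * real k} \<le> \<beta> * real k"
  shows "integrable M (\<lambda>\<omega>. of_bool (X \<omega> \<le> \<beta> * real (R \<omega>)) / real (R \<omega>))" (is "integrable M ?f")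
    and "expectation (\<lambda>\<omega>. of_bool (X \<omega> \<le> \<beta> * real (R \<omega>)) / real (R \<omega>)) \<le> \<beta>"
proof -
  have [measurable]: "random_variable borel X" "random_variable borel (\<lambda>\<omega>. real (R \<omega>))"
    using indep by (auto simp: indep_var_eq)
  have [measurable]: "{\<omega> \<in> space M. R \<omega> = k} \<in> events" for k
  proof -
    have "{\<omega> \<in> space M. real (R \<omega>) = real k} \<in> events" by measurable
    then show ?thesis by simp
  qed
  define E where "E k = {\<omega> \<in> space M. X \<omega> \<le> \<beta> * real k \<and> R \<omega> = k}" for k
  have [measurable]: "E k \<in> events" for k
  proof -
    have "E k = {\<omega> \<in> space M. X \<omega> \<le> \<beta> * real k} \<inter> {\<omega> \<in> space M. R \<omega> = k}"
      by (auto simp: E_def)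
    then show ?thesis by simp
  qed
  have split: "?f \<omega> = (\<Sum>k\<in>{1..m}. indicator (E k) \<omega> / real k)" if "\<omega> \<in> space M" for \<omega>
  proof -
    have "(\<Sum>k\<in>{1..m}. indicator (E k) \<omega> / real k) = (\<Sum>k\<in>{1..m}. if k = R \<omega> then ?f \<omega> else 0)"
      using that by (intro sum.cong) (auto simp: E_def indicator_def)
    then show ?thesis using R[OF that] by simp
  qed
  have int: "integrable M (\<lambda>\<omega>. indicator (E k) \<omega> / real k)" for k
    by (intro integrable_divide_zero integrable_real_indicator) (auto simp: less_top[symmetric])
  show "integrable M ?f"
    by (subst Bochner_Integration.integrable_cong[OF refl split]) (auto intro: int)
  have bound: "prob (E k) / real k \<le> \<beta> * prob {\<omega> \<in> space M. R \<omega> = k}" if k: "k \<in> {1..m}" for k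
  proof -
    have "prob (E k) = prob {\<omega> \<in> space M. X \<omega> \<le> \<beta> * real k} * prob {\<omega> \<in> space M. R \<omega> = k}"
      using indep_varD[OF indep, of "{..\<beta> * real k}" "{real k}"]
      by (simp add: E_def vimage_def Int_def conj_commute)
    also have "\<dots> \<le> (\<beta> * real k) * prob {\<omega> \<in> space M. R \<omega> = k}"
      using superuniform[OF k] by (intro mult_right_mono) auto
    finally show ?thesis using k by (simp add: field_simps)
  qed
  have "expectation ?f = (\<Sum>k\<in>{1..m}. prob (E k) / real k)"
    by (subst Bochner_Integration.integral_cong[OF refl split])
      (auto simp: int Bochner_Integration.integral_sum)
  also have "\<dots> \<le> (\<Sum>k\<in>{1..m}. \<beta> * prob {\<omega> \<in> space M. R \<omega> = k})"
    by (intro sum_mono bound)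
  also have "\<dots> = \<beta> * (\<Sum>k\<in>{1..m}. prob {\<omega> \<in> space M. R \<omega> = k})"
    by (simp add: sum_distrib_left)
  also have "(\<Sum>k\<in>{1..m}. prob {\<omega> \<in> space M. R \<omega> = k}) = prob (\<Union>k\<in>{1..m}. {\<omega> \<in> space M. R \<omega> = k})"
    by (intro finite_measure_finite_Union[symmetric]) (auto simp: disjoint_family_on_def)
  also have "(\<Union>k\<in>{1..m}. {\<omega> \<in> space M. R \<omega> = k}) = space M"
    using R by auto
  finally show "expectation ?f \<le> \<beta>" by (simp add: prob_space)
qed

lemma measurable_card_rejections:
  assumes r: "r = (<) \<or> r = (\<le>)"
    and [measurable]: "\<And>j. j \<in> {1..m} \<Longrightarrow> (\<lambda>q. f q j) \<in> borel_measurable N"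
  shows "(\<lambda>q. card (rejections m \<beta> r (f q))) \<in> N \<rightarrow>\<^sub>M count_space UNIV"
proof -
  have rel: "{q \<in> space N. r (f q k) (f q j)} \<in> sets N" if "k \<in> {1..m}" "j \<in> {1..m}" for k j
    using r that by auto
  have rank[measurable]: "(\<lambda>q. rank_of m r (f q) j) \<in> N \<rightarrow>\<^sub>M count_space UNIV"
    if "j \<in> {1..m}" for j
  proof (unfold rank_of_def, rule measurable_card)
    fix k
    show "{q \<in> space N. k \<in> insert j {k \<in> {1..m}. r (f q k) (f q j)}} \<in> sets N"
      using rel[of k j] that by (cases "k = j"; cases "k \<in> {1..m}") auto
  qed
  show ?thesis
  proof (rule measurable_card)
    fix h
    show "{q \<in> space N. h \<in> rejections m \<beta> r (f q)} \<in> sets N"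
    proof (cases "h \<in> {1..m}")
      case True
      have "{q \<in> space N. \<forall>j\<in>{1..m}. f q j \<le> f q h \<longrightarrow> f q j \<le> \<beta> * real (rank_of m r (f q) j)} \<in> sets N"
      proof (rule sets.sets_Collect_finite_All)
        fix j assume [measurable]: "j \<in> {1..m}"
        have [measurable]: "h \<in> {1..m}" by (rule True)
        show "{q \<in> space N. f q j \<le> f q h \<longrightarrow> f q j \<le> \<beta> * real (rank_of m r (f q) j)} \<in> sets N"
          by measurable
      qed simp
      then show ?thesis using True by (simp add: rejections_def)
    next
      case False
      then show ?thesis by (simp add: rejections_def)
    qed
  qed
qed

lemma (in basic_independence) fdr_rejections_le:
  assumes r: "r = (<) \<or> r = (\<le>)" and "0 \<le> \<beta>" and "\<beta> * real m \<le> 1"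
  shows "fdr M I0 p (rejections m \<beta> r) \<le> \<beta> * real (card I0)"
proof -
  define D where "D \<omega> = rejections m \<beta> r (\<lambda>j. p j \<omega>)" for \<omega>
  define R where "R i \<omega> = card (rejections m \<beta> r ((\<lambda>j. p j \<omega>)(i := 0)))" for i \<omega>
  define f where "f i \<omega> = of_bool (p i \<omega> \<le> \<beta> * real (R i \<omega>)) / real (R i \<omega>)" for i \<omega>
  have I0: "I0 \<subseteq> {1..m}" using index_union by auto
  then have "finite I0" by (rule finite_subset) simp
  have f: "integrable M (f i) \<and> expectation (f i) \<le> \<beta>" if i: "i \<in> I0" for i
  proof -
    let ?q = "\<lambda>\<omega>. \<lambda>j\<in>{1..m} - {i}. p j \<omega>"
    let ?g = "\<lambda>q. real (card (rejections m \<beta> r (q(i := 0))))"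
    have "?g \<in> borel_measurable (\<Pi>\<^sub>M j\<in>{1..m} - {i}. borel)"
    proof (rule measurable_compose[OF measurable_card_rejections[OF r]])
      fix j assume "j \<in> {1..m}"
      then show "(\<lambda>q. (q(i := 0)) j) \<in> borel_measurable (\<Pi>\<^sub>M j\<in>{1..m} - {i}. borel)"
        by (cases "j = i") auto
    qed simp
    then have "indep_var borel (p i) borel (\<lambda>\<omega>. ?g (?q \<omega>))"
      by (rule true_indep_rest[OF i])
    moreover have "?g (?q \<omega>) = real (R i \<omega>)" for \<omega>
    proof -
      have "rejections m \<beta> r ((?q \<omega>)(i := 0)) = rejections m \<beta> r ((\<lambda>j. p j \<omega>)(i := 0))"
        using i I0 \<open>0 \<le> \<beta>\<close> by (intro rejections_rigid[OF r, of _ _ i] zero_mem_rejections) auto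
      then show ?thesis by (simp add: R_def)
    qed
    ultimately have "indep_var borel (p i) borel (\<lambda>\<omega>. real (R i \<omega>))" by simp
    moreover have "R i \<omega> \<in> {1..m}" for \<omega>
    proof -
      have "i \<in> rejections m \<beta> r ((\<lambda>j. p j \<omega>)(i := 0))"
        using i I0 \<open>0 \<le> \<beta>\<close> by (intro zero_mem_rejections) auto
      then have "0 < R i \<omega>" unfolding R_def by (auto simp: card_gt_0_iff)
      moreover have "R i \<omega> \<le> card {1..m}"
        unfolding R_def by (intro card_mono) (auto simp: rejections_def)
      ultimately show ?thesis by simp
    qed
    moreover have "prob {\<omega> \<in> space M. p i \<omega> \<le> \<beta> * real k} \<le> \<beta> * real k" if "k \<in> {1..m}" for k
    proof (rule true_superuniform[OF i])
      have "\<beta> * real k \<le> \<beta> * real m" using that \<open>0 \<le> \<beta>\<close> by (intro mult_left_mono) auto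
      then show "\<beta> * real k \<in> {0..1}" using assms by auto
    qed
    ultimately show ?thesis
      using expectation_random_threshold_le[of "p i" "R i" m \<beta>] unfolding f_def by blast
  qed
  have pointwise: "real (card (D \<omega> \<inter> I0)) / real (max (card (D \<omega>)) 1) \<le> (\<Sum>i\<in>I0. f i \<omega>)" for \<omega>
  proof -
    have "real (card (D \<omega> \<inter> I0)) / real (max (card (D \<omega>)) 1)
        = (\<Sum>i\<in>D \<omega> \<inter> I0. 1 / real (max (card (D \<omega>)) 1))"
      by simp
    also have "\<dots> \<le> (\<Sum>i\<in>D \<omega> \<inter> I0. f i \<omega>)"
    proof (rule sum_mono)
      fix i assume i: "i \<in> D \<omega> \<inter> I0"
      have "D \<omega> = rejections m \<beta> r ((\<lambda>j. p j \<omega>)(i := 0))"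
        unfolding D_def
        using i I0 \<open>0 \<le> \<beta>\<close> by (intro rejections_rigid[OF r, of _ _ i] zero_mem_rejections) (auto simp: D_def)
      then have R: "R i \<omega> = card (D \<omega>)" by (simp add: R_def)
      have "0 < card (D \<omega>)" using i by (auto simp: card_gt_0_iff D_def)
      moreover have "p i \<omega> \<le> \<beta> * real (card (D \<omega>))"
        using rejections_le[OF r \<open>0 \<le> \<beta>\<close>, of i m "\<lambda>j. p j \<omega>"] i by (simp add: D_def)
      ultimately show "1 / real (max (card (D \<omega>)) 1) \<le> f i \<omega>" by (simp add: f_def R max_def)
    qed
    also have "\<dots> \<le> (\<Sum>i\<in>I0. f i \<omega>)"
      using \<open>finite I0\<close> by (intro sum_mono2) (auto simp: f_def)
    finally show ?thesis .
  qed
  have "fdr M I0 p (rejections m \<beta> r) =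
      expectation (\<lambda>\<omega>. real (card (D \<omega> \<inter> I0)) / real (max (card (D \<omega>)) 1))"
    by (simp only: fdr_def D_def Let_def)
  also have "\<dots> \<le> expectation (\<lambda>\<omega>. \<Sum>i\<in>I0. f i \<omega>)"
  proof (rule integral_mono')
    show "integrable M (\<lambda>\<omega>. \<Sum>i\<in>I0. f i \<omega>)"
      using f by (intro Bochner_Integration.integrable_sum) blast
    show "0 \<le> (\<Sum>i\<in>I0. f i \<omega>)" for \<omega> by (intro sum_nonneg) (simp add: f_def)
  qed (rule pointwise)
  also have "\<dots> = (\<Sum>i\<in>I0. expectation (f i))"
    using f by (intro Bochner_Integration.integral_sum) auto
  also have "\<dots> \<le> (\<Sum>i\<in>I0. \<beta>)" using f by (intro sum_mono) auto
  finally show ?thesis by (simp add: mult.commute)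
qed

section \<open>False discovery rate of the two step down tests\<close>

theorem theorem6:
  fixes M :: "'w measure" and m :: nat and \<alpha> :: real
    and I0 I1 :: "nat set" and p :: "nat \<Rightarrow> 'w \<Rightarrow> real"
  assumes "m \<ge> 1"
    and "\<alpha> \<in> {0<..<1}"
    and "basic_independence M m I0 I1 p"
  shows "fdr M I0 p (sd_test m (\<lambda>x i. crit_b m \<alpha> (real i))) \<le> \<alpha> * real (card I0) / real m
       \<and> fdr M I0 p (sd_test m (crit_a m \<alpha>)) \<le> \<alpha> * real (card I0) / real m"
proof -
  interpret basic_independence M m I0 I1 p by fact
  have "sd_test m (\<lambda>x i. crit_b m \<alpha> (real i)) = rejections m (\<alpha> / real m) (<)"
    and "sd_test m (crit_a m \<alpha>) = rejections m (\<alpha> / real m) (\<le>)"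
    using assms(1,2) by (auto simp: sd_test_crit_a sd_test_crit_b)
  moreover have "fdr M I0 p (rejections m (\<alpha> / real m) r) \<le> \<alpha> * real (card I0) / real m"
    if "r = (<) \<or> r = (\<le>)" for r
    using fdr_rejections_le[OF that, of "\<alpha> / real m"] assms(1,2) by simp
  ultimately show ?thesis by simp
qed

end
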